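(* Let $(h,a)$ be a random history-action pair, let $A = A(h,a)$ be its (real-valued) advantage, with $\mathbb{E}[A^2]<\infty$, and let $C$ be the cluster label of $(h,a)$, taking values in a finite set. Let $\tilde{A} = \mathbb{E}[A \mid C]$ be the aggregated (cluster-averaged) advantage. Then $$\mathrm{Var}(\tilde{A}) \leq \mathrm{Var}(A).$$
   Context: A language agent acts in a partially observable decision process; at step $t$ it has a history $h_t$ of past actions and observations and takes an action $a_t$. A clustering function $c_k$ assigns each action and each observation one of $k$ labels. The cluster label $C$ of a history-action pair $(h_t,a_t)$ is the sequence of labels $(c_k(a_1), c_k(o_1), \dots, c_k(a_{t-1}), c_k(o_{t-1}), c_k(a_t))$, so $C$ is a deterministic function of $(h_t,a_t)$. The aggregated advantage $\tilde{A}(h,a)$ replaces the original advantage $A(h,a)$ by the average of $A$ over all pairs sharing the cluster label of $(h,a)$, i.e. $\tilde{A} = \mathbb{E}[A\mid C]$. *)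

theory Defs
  imports "HOL-Probability.Probability"
begin

text \<open>
  A history \<open>[(a\<^sub>1, o\<^sub>1), \<dots>, (a\<^bsub>t-1\<^esub>, o\<^bsub>t-1\<^esub>)]\<close> lists the past action-observation
  pairs in chronological order.
\<close>

type_synonym ('a, 'o) history = "('a \<times> 'o) list"

text \<open>
  One clustering function labels both actions and observations, hence the sum type;
  the \<open>k\<close> labels are the natural numbers below \<open>k\<close>.
\<close>

definition clustering :: "nat \<Rightarrow> ('a + 'o \<Rightarrow> nat) \<Rightarrow> bool" where
  "clustering k c \<longleftrightarrow> (\<forall>z. c z < k)"

definition cluster_label :: "('a + 'o \<Rightarrow> nat) \<Rightarrow> ('a, 'o) history \<times> 'a \<Rightarrow> nat list" where
  "cluster_label c = (\<lambda>(h, a). concat (map (\<lambda>(a', o'). [c (Inl a'), c (Inr o')]) h) @ [c (Inl a)])"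

text \<open>
  The conditional expectation of \<open>A(h, a)\<close> given \<open>C\<close>, where \<open>H \<omega>\<close> is the random pair \<open>(h, a)\<close>:
  conditioning is on the \<open>\<sigma>\<close>-algebra generated by the discrete random variable \<open>C\<close>.
\<close>

definition aggregated_advantage ::
  "'w measure \<Rightarrow> ('a + 'o \<Rightarrow> nat) \<Rightarrow> ('w \<Rightarrow> ('a, 'o) history \<times> 'a) \<Rightarrow>
    (('a, 'o) history \<times> 'a \<Rightarrow> real) \<Rightarrow> 'w \<Rightarrow> real" where
  "aggregated_advantage M c H A =
    real_cond_exp M
      (vimage_algebra (space M) (\<lambda>\<omega>. cluster_label c (H \<omega>)) (count_space UNIV))
      (\<lambda>\<omega>. A (H \<omega>))"

end

theory Submission
  imports Defs
begin

text \<open>Conditioning keeps the mean m of X, and conditional Jensen for the convex map y -> (y -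
  m)^2 bounds (E[X|F] - m)^2 by E[(X - m)^2|F] almost everywhere. Integrating both sides gives
  Var(E[X|F]) \<le> Var(X) for every sub-sigma-algebra F. The theorem is the case where F is
  generated by the cluster label.\<close>

lemma (in prob_space) variance_real_cond_exp_le:
  fixes X :: "'a \<Rightarrow> real"
  assumes sub: "subalgebra M F"
    and X[measurable]: "X \<in> borel_measurable M"
    and X2: "integrable M (\<lambda>x. (X x)\<^sup>2)"
  shows "variance (real_cond_exp M F X) \<le> variance X"
proof -
  interpret finite_measure_subalgebra M F
    using sub by unfold_locales
  have intX: "integrable M X"
    using square_integrable_imp_integrable[OF X X2] .
  define q where "q = (\<lambda>x. (x - expectation X)\<^sup>2)"
  have q_int: "integrable M (\<lambda>x. q (X x))"
    using intX X2 by (simp add: q_def power2_diff)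
  have "convex_on UNIV q"
    unfolding q_def
    by (rule f''_ge0_imp_convex[where f' = "\<lambda>x. 2 * (x - expectation X)" and f'' = "\<lambda>_. 2"])
      (auto intro!: derivative_eq_intros)
  moreover have "q \<in> borel_measurable borel"
    unfolding q_def by measurable
  ultimately have jensen: "AE x in M. q (real_cond_exp M F X x) \<le> real_cond_exp M F (\<lambda>x. q (X x)) x"
    by (intro real_cond_exp_jensens_inequality(2)[where I = UNIV]) (use intX q_int in auto)
  \<comment> \<open>Since E[X|F] has the same mean as X, the centring constant in \<open>q\<close>
    serves both variances.\<close>
  have "variance (real_cond_exp M F X) = (\<integral>x. q (real_cond_exp M F X x) \<partial>M)"
    using real_cond_exp_int(2)[OF intX] by (simp add: q_def)
  also have "\<dots> \<le> (\<integral>x. real_cond_exp M F (\<lambda>x. q (X x)) x \<partial>M)"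
  \<comment> \<open>This rule asks for an integrable, nonnegative upper bound, so integrability of
    the smaller integrand need not be shown separately.\<close>
  proof (rule integral_mono_AE')
    have "0 \<le> q y" for y by (simp add: q_def)
    with jensen show "AE x in M. 0 \<le> real_cond_exp M F (\<lambda>x. q (X x)) x"
      by (auto elim!: eventually_mono intro: order_trans)
  qed (use real_cond_exp_int(1)[OF q_int] jensen in auto)
  also have "\<dots> = variance X"
    using real_cond_exp_int(2)[OF q_int] by (simp add: q_def)
  finally show ?thesis .
qed

text \<open>Measurability of \<open>f\<close> puts each generating preimage in \<open>M\<close>, so
  conditioning on \<open>f\<close> is legitimate.\<close>

lemma subalgebra_vimage_algebra:
  assumes "f \<in> measurable M N"
  shows "subalgebra M (vimage_algebra (space M) f N)"
  using assms by (auto simp: subalgebra_def intro: sets_image_in_sets[THEN subsetD, rotated 2])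

theorem lemma4p1:
  fixes M :: "'w measure"
    and N :: "(('a, 'o) history \<times> 'a) measure"
    and H :: "'w \<Rightarrow> ('a, 'o) history \<times> 'a"
    and A :: "('a, 'o) history \<times> 'a \<Rightarrow> real"
    and c :: "'a + 'o \<Rightarrow> nat"
    and k :: nat
  assumes "prob_space M"
    and "H \<in> measurable M N"
    and "A \<in> borel_measurable N"
    and "integrable M (\<lambda>\<omega>. (A (H \<omega>))\<^sup>2)"
    and "clustering k c"
    and "cluster_label c \<in> measurable N (count_space UNIV)"
    and "finite ((\<lambda>\<omega>. cluster_label c (H \<omega>)) ` space M)"
  shows "prob_space.variance M (aggregated_advantage M c H A)
       \<le> prob_space.variance M (\<lambda>\<omega>. A (H \<omega>))"
proof -
  interpret prob_space M by fact
  note [measurable] = assms(2,3,6)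
  show ?thesis
    unfolding aggregated_advantage_def
    \<comment> \<open>What remains is measurability of the advantage and of the label, both
      compositions with \<open>H\<close>, and square integrability.\<close>
    by (intro variance_real_cond_exp_le subalgebra_vimage_algebra) (use assms(4) in measurable)
qed

end
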